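(* There exists a $4$-sparse $4$-cycle system of order $v$ if and only if $v\equiv 1 \pmod 8$.
   Context: A $4$-cycle is a cycle of length four, written $(a,b,c,d)$ with edges $\{a,b\},\{b,c\},\{c,d\},\{d,a\}$. A $4$-cycle system of order $v$, $4\mathrm{CS}(v)$, is a pair $(V,\mathcal{C})$ where $V$ is the vertex set of $K_v$ and $\mathcal{C}$ is a collection of edge-disjoint $4$-cycles whose edges partition the edge set of $K_v$. A $(k,l)$-configuration in a $4$CS is a set of $l$ of its $4$-cycles whose union contains precisely $k$ vertices. A $4$CS is $r$-sparse if it contains no $(j+3,j)$-configuration for any integer $j$ with $2\le j\le r$. *)

theory Defs
  imports "HOL-Library.Disjoint_Sets" "HOL-Library.Ramsey" "HOL-Number_Theory.Cong"
begin

text \<open>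
  A 4-cycle is represented by its set of edges, an edge being a two-element set of vertices.
  Since a 4-cycle has no isolated vertices, its vertex set is the union of its edges.
\<close>

definition cycle4 :: "'a \<Rightarrow> 'a \<Rightarrow> 'a \<Rightarrow> 'a \<Rightarrow> 'a set set" where
  "cycle4 a b c d = {{a, b}, {b, c}, {c, d}, {d, a}}"

definition is_4_cycle :: "'a set set \<Rightarrow> bool" where
  "is_4_cycle E \<longleftrightarrow> (\<exists>a b c d. distinct [a, b, c, d] \<and> E = cycle4 a b c d)"

text \<open>
  The edge set of the complete graph on \<open>V\<close> is \<open>nsets V 2\<close>, the set of two-element subsets
  of \<open>V\<close>.  A plain set of cycles suffices, because edge-disjoint cycles are never repeated.
\<close>

definition four_cycle_system :: "'a set \<Rightarrow> 'a set set set \<Rightarrow> bool" where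
  "four_cycle_system V C \<longleftrightarrow>
     finite V \<and> (\<forall>E\<in>C. is_4_cycle E) \<and> partition_on (nsets V 2) C"

definition configuration :: "nat \<Rightarrow> nat \<Rightarrow> 'a set set set \<Rightarrow> 'a set set set \<Rightarrow> bool" where
  "configuration k l C S \<longleftrightarrow>
     S \<subseteq> C \<and> finite S \<and> card S = l \<and> card (\<Union>E\<in>S. \<Union>E) = k"

definition sparse_system :: "nat \<Rightarrow> 'a set set set \<Rightarrow> bool" where
  "sparse_system r C \<longleftrightarrow>
     (\<forall>j. 2 \<le> j \<and> j \<le> r \<longrightarrow> \<not> (\<exists>S. configuration (j + 3) j C S))"

end

theory Submission
  imports Defs
begin

text \<open>
  Necessity is the parity of the degrees together with the count of the edges.

  For \<open>v = 8 * t + 1\<close> take the translates modulo \<open>v\<close> of the cycles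
  \<open>(s, s + 4i + 1, s - 1, s - 4i - 4)\<close> with \<open>0 \<le> i < t\<close>, whose edge lengths are
  \<open>4i + 1, \<dots>, 4i + 4\<close>.  Edge-disjoint cycles share at most two points, and a
  \<open>(6,3)\<close>- or \<open>(7,4)\<close>-configuration contains three cycles on at most seven points that meet
  pairwise in two points.  Two cycles that meet in two points have translation parts differing
  by \<open>0\<close>, \<open>\<plusminus>1\<close> or \<open>\<plusminus>(4i + 4)\<close>, according to the diagonal involved.  Around a triangle these
  shifts add up to a multiple of \<open>v\<close>; reducing modulo \<open>4\<close> and comparing sizes shows for
  \<open>t \<ge> 2\<close> that the three cycles have a common pair, and then they cover eight points.
\<close>

section \<open>Necessity\<close>

lemma card_is_4_cycle:
  assumes "is_4_cycle E"
  shows "card E = 4"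
proof -
  obtain a b c d where "distinct [a, b, c, d]" "E = cycle4 a b c d"
    using assms unfolding is_4_cycle_def by blast
  then show ?thesis
    by (auto simp: cycle4_def doubleton_eq_iff card_insert_if)
qed

lemma even_degree_is_4_cycle:
  assumes "is_4_cycle E"
  shows "even (card {e \<in> E. x \<in> e})"
proof -
  obtain a b c d where abcd: "distinct [a, b, c, d]" and E: "E = cycle4 a b c d"
    using assms unfolding is_4_cycle_def by blast
  \<comment> \<open>Filters an explicit cycle edge by edge, so that the edges at \<open>x\<close>
    can be counted by simplification.\<close>
  have split: "{e \<in> insert u U. x \<in> e} = (if x \<in> u then insert u {e \<in> U. x \<in> e}
      else {e \<in> U. x \<in> e})" for u and U :: "'a set set"
    by auto
  have "a \<noteq> b" "b \<noteq> a" "a \<noteq> c" "c \<noteq> a" "a \<noteq> d" "d \<noteq> a" "b \<noteq> c" "c \<noteq> b" "b \<noteq> d" "d \<noteq> b"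
      "c \<noteq> d" "d \<noteq> c"
    using abcd by auto
  moreover consider "x = a" | "x = b" | "x = c" | "x = d" | "x \<notin> {a, b, c, d}"
    by blast
  ultimately show ?thesis
    unfolding E cycle4_def split by cases (simp_all add: doubleton_eq_iff)
qed

lemma card_incident_pairs:
  assumes "finite V" "x \<in> V"
  shows "card {e \<in> nsets V 2. x \<in> e} = card V - 1"
proof -
  have "{e \<in> nsets V 2. x \<in> e} = (\<lambda>y. {x, y}) ` (V - {x})"
  proof -
    have "e \<in> (\<lambda>y. {x, y}) ` (V - {x})" if e: "e \<in> nsets V 2" "x \<in> e" for e
    proof -
      have "e \<subseteq> V" "card e = 2"
        using e by (auto simp: nsets_def)
      then obtain y where "e = {x, y}" "x \<noteq> y"
        using e(2) by (auto simp: card_2_iff)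
      then show ?thesis
        using \<open>e \<subseteq> V\<close> by auto
    qed
    then show ?thesis
      using assms by (auto simp: nsets_def)
  qed
  moreover have "inj_on (\<lambda>y. {x, y}) (V - {x})"
    by (auto simp: inj_on_def doubleton_eq_iff)
  ultimately show ?thesis
    using assms by (simp add: card_image)
qed

text \<open>Every cycle has an even number of edges at a vertex, so \<open>card V - 1\<close> is
  even, say \<open>2 * w\<close>. Counting edges gives \<open>4 * card C = w * (2 * w + 1)\<close>,
  and \<open>4\<close> is coprime to the odd factor, hence divides \<open>w\<close>.\<close>

lemma four_cycle_system_cong:
  assumes sys: "four_cycle_system V C" and "V \<noteq> {}"
  shows "[card V = 1] (mod 8)"
proof -
  have fin: "finite V" and cyc: "\<And>E. E \<in> C \<Longrightarrow> is_4_cycle E"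
    and part: "partition_on (nsets V 2) C"
    using sys unfolding four_cycle_system_def by auto
  have Union: "\<Union>C = nsets V 2" and disj: "disjoint C"
    using part by (auto simp: partition_on_def)
  have finN: "finite (nsets V 2)"
    using fin by (rule finite_imp_finite_nsets)
  have finE: "finite E" if "E \<in> C" for E
    using that finN Union by (metis Union_upper finite_subset)
  have finC: "finite C"
    using finN Union by (metis finite_UnionD)
  obtain x where x: "x \<in> V"
    using \<open>V \<noteq> {}\<close> by blast
  have "card {e \<in> nsets V 2. x \<in> e} = card (\<Union>E\<in>C. {e \<in> E. x \<in> e})"
    unfolding Union [symmetric] by (rule arg_cong [where f = card]) auto
  also have "\<dots> = (\<Sum>E\<in>C. card {e \<in> E. x \<in> e})"
  proof (rule card_UN_disjoint [OF finC])
    show "\<forall>E\<in>C. finite {e \<in> E. x \<in> e}"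
      using finE by auto
    show "\<forall>E\<in>C. \<forall>F\<in>C. E \<noteq> F \<longrightarrow> {e \<in> E. x \<in> e} \<inter> {e \<in> F. x \<in> e} = {}"
      using disj by (auto simp: disjoint_def)
  qed
  also have "even \<dots>"
    by (intro dvd_sum even_degree_is_4_cycle cyc)
  finally have "even (card V - 1)"
    using card_incident_pairs [OF fin x] by simp
  moreover have "card V > 0"
    using fin \<open>V \<noteq> {}\<close> by auto
  ultimately obtain w where w: "card V = 2 * w + 1"
    by (metis Suc_eq_plus1 Suc_pred' dvd_def)
  have "card (nsets V 2) = (\<Sum>E\<in>C. card E)"
    unfolding Union [symmetric]
    by (rule card_Union_disjoint) (use disj finE in \<open>auto simp: disjoint_def pairwise_def disjnt_def\<close>)
  also have "\<dots> = 4 * card C"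
    by (simp add: card_is_4_cycle [OF cyc])
  finally have "4 * card C = w * (2 * w + 1)"
    by (simp add: w choose_two)
  then have "4 dvd w * (2 * w + 1)"
    by (metis dvd_triv_left)
  moreover have "coprime (4::nat) (2 * w + 1)"
    using coprime_power_left_iff [of "2::nat" 2 "2 * w + 1"] by simp
  ultimately have "4 dvd w"
    using coprime_dvd_mult_left_iff by blast
  then show ?thesis
    by (auto simp: w cong_def)
qed

section \<open>Sparseness from pairwise intersections\<close>

text \<open>The two diagonals of a 4-cycle are disjoint, so at most one of the three pairs in a
  triple of vertices is a diagonal.\<close>

lemma is_4_cycle_no_diagonal_triangle:
  assumes "is_4_cycle E" "{x, y, z} \<subseteq> \<Union>E" "x \<noteq> y" "y \<noteq> z" "x \<noteq> z"
  shows "({x, y} \<in> E \<or> {y, z} \<in> E) \<and> ({y, z} \<in> E \<or> {x, z} \<in> E) \<and> ({x, y} \<in> E \<or> {x, z} \<in> E)"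
proof -
  obtain a b c d where "distinct [a, b, c, d]" and E: "E = cycle4 a b c d"
    using assms(1) unfolding is_4_cycle_def by blast
  have "x \<in> {a, b, c, d}" "y \<in> {a, b, c, d}" "z \<in> {a, b, c, d}"
    using assms(2) unfolding E cycle4_def by blast+
  then show ?thesis
    using assms(3-5) unfolding E cycle4_def insert_iff empty_iff
    by (elim disjE) (simp_all add: insert_commute)
qed

lemma card_Union_is_4_cycle:
  assumes "is_4_cycle E"
  shows "card (\<Union>E) = 4"
proof -
  obtain a b c d where "distinct [a, b, c, d]" "E = cycle4 a b c d"
    using assms unfolding is_4_cycle_def by blast
  moreover from this have "\<Union>E = {a, b, c, d}"
    by (auto simp: cycle4_def)
  ultimately show ?thesis
    by simp
qed

text \<open>Of the three pairs in a common triple each cycle misses at most one, so some pair would be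
  an edge of both.\<close>

lemma card_Int_edge_disjoint_4_cycles:
  assumes "is_4_cycle E" "is_4_cycle F" "E \<inter> F = {}"
  shows "card (\<Union>E \<inter> \<Union>F) \<le> 2"
proof (rule ccontr)
  assume "\<not> ?thesis"
  then have "3 \<le> card (\<Union>E \<inter> \<Union>F)"
    by simp
  then obtain T where T: "T \<subseteq> \<Union>E \<inter> \<Union>F" "card T = 3"
    by (meson obtain_subset_with_card_n)
  then obtain x y z where "T = {x, y, z}" "x \<noteq> y" "y \<noteq> z" "x \<noteq> z"
    by (auto simp: card_3_iff)
  then show False
    using T(1) is_4_cycle_no_diagonal_triangle [OF assms(1), of x y z]
      is_4_cycle_no_diagonal_triangle [OF assms(2), of x y z] assms(3) by blast
qed

text \<open>Two 4-sets inside a 6-set meet in at least two points.\<close>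

lemma card_Int_of_three_four_sets:
  assumes "card A = 4" "card B = 4" "card D = 4"
    and "card (A \<inter> B) \<le> 2" "card (A \<inter> D) \<le> 2" "card (B \<inter> D) \<le> 2"
    and "card (A \<union> B \<union> D) = 6"
  shows "card (A \<inter> B) = 2 \<and> card (A \<inter> D) = 2 \<and> card (B \<inter> D) = 2"
proof -
  have fin: "finite A" "finite B" "finite D"
    using assms by (auto intro: card_ge_0_finite)
  have "card (A \<union> B) \<le> 6" "card (A \<union> D) \<le> 6" "card (B \<union> D) \<le> 6"
    unfolding assms(7) [symmetric] by (intro card_mono; use fin in auto)+
  then show ?thesis
    using assms card_Un_Int [of A B] card_Un_Int [of A D] card_Un_Int [of B D] fin by simp
qed

text \<open>The parts of \<open>D\<close> in \<open>A\<close> and in \<open>B\<close> have at most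
  two points each and together make up four, so both bounds are attained and the parts are
  disjoint.\<close>

lemma card_Int_of_set_in_Un:
  assumes fin: "finite A" "finite B" and "D \<subseteq> A \<union> B" "card D = 4"
    and "card (A \<inter> D) \<le> 2" "card (B \<inter> D) \<le> 2"
  shows "card (A \<inter> D) = 2 \<and> card (B \<inter> D) = 2 \<and> A \<inter> B \<inter> D = {}"
proof -
  have "(A \<inter> D) \<union> (B \<inter> D) = D"
    using assms(3) by auto
  moreover have "(A \<inter> D) \<inter> (B \<inter> D) = A \<inter> B \<inter> D"
    by auto
  ultimately have "card (A \<inter> D) + card (B \<inter> D) = 4 + card (A \<inter> B \<inter> D)"
    using card_Un_Int [of "A \<inter> D" "B \<inter> D"] fin assms(4) by simp
  then have "card (A \<inter> D) = 2" "card (B \<inter> D) = 2" "card (A \<inter> B \<inter> D) = 0"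
    using assms(5,6) by linarith+
  then show ?thesis
    using fin by simp
qed

text \<open>Two of the four sets sharing at most one point already cover all seven points, which puts
  the other two in the situation of the previous lemma.\<close>

lemma triangle_of_nearly_disjoint_pair:
  assumes "card A = 4" "card B = 4" "card D = 4" "card E = 4"
    and "card (A \<inter> D) \<le> 2" "card (A \<inter> E) \<le> 2" "card (B \<inter> D) \<le> 2" "card (B \<inter> E) \<le> 2"
    and "card (D \<inter> E) \<le> 2" and union: "card (A \<union> B \<union> D \<union> E) = 7" and AB: "card (A \<inter> B) \<le> 1"
  shows "card (A \<inter> D) = 2 \<and> card (A \<inter> E) = 2 \<and> card (D \<inter> E) = 2"
proof -
  have fin: "finite A" "finite B" "finite D" "finite E"
    using assms by (auto intro: card_ge_0_finite)
  have AB_le: "card (A \<union> B) \<le> 7" and DE_le: "card (D \<union> E) \<le> 7"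
    unfolding union [symmetric] by (intro card_mono; use fin in auto)+
  have AB_eq: "card (A \<union> B) = 7 \<and> card (A \<inter> B) = 1"
    using card_Un_Int [of A B] fin assms(1,2) AB AB_le by simp
  have AB_all: "A \<union> B = A \<union> B \<union> D \<union> E"
    by (rule card_subset_eq) (use fin AB_eq union in auto)
  have D: "card (A \<inter> D) = 2 \<and> card (B \<inter> D) = 2 \<and> A \<inter> B \<inter> D = {}"
    and E: "card (A \<inter> E) = 2 \<and> card (B \<inter> E) = 2 \<and> A \<inter> B \<inter> E = {}"
    using assms fin AB_all by (intro card_Int_of_set_in_Un; auto)+
  \<comment> \<open>Otherwise \<open>D\<close> and \<open>E\<close> would also cover all seven
    points, including the one point of \<open>A \<inter> B\<close>, which lies in neither.\<close>
  have "card (D \<inter> E) = 2"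
  proof (rule ccontr)
    assume "card (D \<inter> E) \<noteq> 2"
    then have "card (D \<union> E) = 7"
      using card_Un_Int [of D E] fin assms(3,4,9) DE_le by simp
    then have "D \<union> E = A \<union> B \<union> D \<union> E"
      by (intro card_subset_eq) (use fin union in auto)
    then have "A \<inter> B = {}"
      using D E by blast
    then show False
      using AB_eq by simp
  qed
  then show ?thesis
    using D E by simp
qed

definition triangle :: "'a set \<Rightarrow> 'a set \<Rightarrow> 'a set \<Rightarrow> bool" where
  "triangle A B D \<longleftrightarrow> card (A \<inter> B) = 2 \<and> card (A \<inter> D) = 2 \<and> card (B \<inter> D) = 2"

text \<open>Either all pairs among \<open>A\<close>, \<open>B\<close>, \<open>D\<close> meet in two
  points, or one of these pairs is nearly disjoint and its first member forms a triangle with the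
  two sets outside the pair.\<close>

lemma triangle_of_four_sets_on_seven_points:
  assumes card4: "card A = 4" "card B = 4" "card D = 4" "card E = 4"
    and le: "card (A \<inter> B) \<le> 2" "card (A \<inter> D) \<le> 2" "card (A \<inter> E) \<le> 2"
      "card (B \<inter> D) \<le> 2" "card (B \<inter> E) \<le> 2" "card (D \<inter> E) \<le> 2"
    and union: "card (A \<union> B \<union> D \<union> E) = 7"
  shows "triangle A B D \<or> triangle A B E \<or> triangle A D E"
proof -
  have "triangle A D E" if "card (A \<inter> B) \<le> 1"
    unfolding triangle_def using that card4 le union
    by (intro triangle_of_nearly_disjoint_pair [of A B D E]) auto
  moreover have "triangle A B E" if "card (A \<inter> D) \<le> 1"
    unfolding triangle_def using that card4 le union
    by (intro triangle_of_nearly_disjoint_pair [of A D B E]) (auto simp: Un_ac Int_commute)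
  moreover have "triangle B A E" if "card (B \<inter> D) \<le> 1"
    unfolding triangle_def using that card4 le union
    by (intro triangle_of_nearly_disjoint_pair [of B D A E]) (auto simp: Un_ac Int_commute)
  moreover have "triangle A B D"
    if "\<not> card (A \<inter> B) \<le> 1" "\<not> card (A \<inter> D) \<le> 1" "\<not> card (B \<inter> D) \<le> 1"
    using that le unfolding triangle_def by linarith
  ultimately show ?thesis
    unfolding triangle_def by (metis Int_commute)
qed

text \<open>Inclusion and exclusion: at least \<open>4 + 4 + 4 - 2 - 2 - 2 + 2 = 8\<close>
  points.\<close>

lemma card_Un_triangle:
  assumes "card A = 4" "card B = 4" "card D = 4" "triangle A B D" "2 \<le> card (A \<inter> B \<inter> D)"
  shows "8 \<le> card (A \<union> B \<union> D)"
proof -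
  have fin: "finite A" "finite B" "finite D"
    using assms by (auto intro: card_ge_0_finite)
  have "card (A \<union> B) = 6"
    using card_Un_Int [of A B] fin assms by (simp add: triangle_def)
  moreover have "card ((A \<inter> D) \<union> (B \<inter> D)) \<le> 2"
  proof -
    have "(A \<inter> D) \<inter> (B \<inter> D) = A \<inter> B \<inter> D"
      by auto
    then show ?thesis
      using card_Un_Int [of "A \<inter> D" "B \<inter> D"] fin assms(4,5) by (simp add: triangle_def)
  qed
  moreover have "(A \<union> B) \<inter> D = (A \<inter> D) \<union> (B \<inter> D)"
    by auto
  ultimately show ?thesis
    using card_Un_Int [of "A \<union> B" D] fin assms(3) by simp
qed

text \<open>A \<open>(5,2)\<close>-configuration would have two cycles sharing three points; a
  \<open>(6,3)\<close>-configuration is itself a triangle, and a \<open>(7,4)\<close>-configuration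
  contains one, in both cases on fewer than eight points.\<close>

lemma sparse_system_4_if_triangles_large:
  assumes cyc: "\<And>E. E \<in> C \<Longrightarrow> is_4_cycle E" and "disjoint C"
    and large: "\<And>E F G. \<lbrakk>E \<in> C; F \<in> C; G \<in> C; distinct [E, F, G]; triangle (\<Union>E) (\<Union>F) (\<Union>G)\<rbrakk>
      \<Longrightarrow> 8 \<le> card (\<Union>E \<union> \<Union>F \<union> \<Union>G)"
  shows "sparse_system 4 C"
proof -
  have card4: "card (\<Union>E) = 4" if "E \<in> C" for E
    by (rule card_Union_is_4_cycle [OF cyc [OF that]])
  have le: "card (\<Union>E \<inter> \<Union>F) \<le> 2" if "E \<in> C" "F \<in> C" "E \<noteq> F" for E F
    using that \<open>disjoint C\<close> by (intro card_Int_edge_disjoint_4_cycles cyc) (auto simp: disjoint_def)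
  have fin: "finite (\<Union>E)" if "E \<in> C" for E
    using card4 [OF that] by (auto intro: card_ge_0_finite)
  have "\<not> configuration 5 2 C S" for S
  proof
    assume conf: "configuration 5 2 C S"
    then obtain E F where S: "S = {E, F}" "E \<noteq> F"
      by (auto simp: configuration_def card_2_iff)
    then have "E \<in> C" "F \<in> C" "card (\<Union>E \<union> \<Union>F) = 5"
      using conf by (auto simp: configuration_def)
    then show False
      using card_Un_Int [OF fin fin, of E F] card4 le [of E F] S(2) by simp
  qed
  moreover have "\<not> configuration 6 3 C S" for S
  proof
    assume conf: "configuration 6 3 C S"
    then obtain E F G where S: "S = {E, F, G}" "E \<noteq> F" "F \<noteq> G" "E \<noteq> G"
      by (auto simp: configuration_def card_3_iff)
    then have mem: "E \<in> C" "F \<in> C" "G \<in> C" and six: "card (\<Union>E \<union> \<Union>F \<union> \<Union>G) = 6"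
      using conf by (auto simp: configuration_def Un_assoc)
    then have "triangle (\<Union>E) (\<Union>F) (\<Union>G)"
      unfolding triangle_def using S by (intro card_Int_of_three_four_sets card4 le) auto
    then show False
      using large [of E F G] S mem six by simp
  qed
  moreover have "\<not> configuration 7 4 C S" for S
  proof
    assume conf: "configuration 7 4 C S"
    then have "card S = Suc 3"
      by (simp add: configuration_def)
    then obtain E S' where "S = insert E S'" "E \<notin> S'" "card S' = 3"
      unfolding card_Suc_eq by blast
    then obtain F G H where S: "S = {E, F, G, H}" and "distinct [E, F, G, H]"
      by (auto simp: card_3_iff)
    then have mem: "E \<in> C" "F \<in> C" "G \<in> C" "H \<in> C"
      and seven: "card (\<Union>E \<union> \<Union>F \<union> \<Union>G \<union> \<Union>H) = 7"
      using conf by (auto simp: configuration_def Un_assoc)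
    have "triangle (\<Union>E) (\<Union>F) (\<Union>G) \<or> triangle (\<Union>E) (\<Union>F) (\<Union>H)
        \<or> triangle (\<Union>E) (\<Union>G) (\<Union>H)"
      using \<open>distinct [E, F, G, H]\<close> mem seven
      by (intro triangle_of_four_sets_on_seven_points card4 le) auto
    then have "8 \<le> card (\<Union>E \<union> \<Union>F \<union> \<Union>G) \<or> 8 \<le> card (\<Union>E \<union> \<Union>F \<union> \<Union>H)
        \<or> 8 \<le> card (\<Union>E \<union> \<Union>G \<union> \<Union>H)"
      using large [of E F G] large [of E F H] large [of E G H] mem \<open>distinct [E, F, G, H]\<close> by auto
    moreover have "card (\<Union>E \<union> \<Union>F \<union> \<Union>G) \<le> 7" "card (\<Union>E \<union> \<Union>F \<union> \<Union>H) \<le> 7"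
        "card (\<Union>E \<union> \<Union>G \<union> \<Union>H) \<le> 7"
      unfolding seven [symmetric] by (intro card_mono; use fin mem in auto)+
    ultimately show False
      by linarith
  qed
  moreover have "j = 2 \<or> j = 3 \<or> j = 4" if "2 \<le> j" "j \<le> 4" for j :: nat
    using that by linarith
  ultimately show ?thesis
    unfolding sparse_system_def by fastforce
qed

section \<open>The cyclic systems\<close>

locale cyclic_4_cycles =
  fixes t :: int
  assumes t_nonneg: "0 \<le> t"
begin

abbreviation v :: int where "v \<equiv> 8 * t + 1"

text \<open>Differences are computed in the integers; \<open>pt\<close> turns a residue class modulo
  \<open>v\<close> into a vertex below \<open>v\<close>.\<close>

definition pt :: "int \<Rightarrow> nat" where
  "pt x = nat (x mod v)"

definition seg :: "int \<Rightarrow> int \<Rightarrow> nat set" where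
  "seg x d = {pt x, pt (x + d)}"

definition cyc :: "int \<Rightarrow> int \<Rightarrow> nat set set" where
  "cyc i s = cycle4 (pt s) (pt (s + 4 * i + 1)) (pt (s - 1)) (pt (s - 4 * i - 4))"

definition cycles :: "nat set set set" where
  "cycles = {cyc i s |i s. i \<in> {0..<t} \<and> s \<in> {0..<v}}"

section \<open>Edges modulo \<open>v\<close> and their lengths\<close>

lemma pt_eq_iff: "pt x = pt y \<longleftrightarrow> v dvd x - y"
proof -
  have "pt x = pt y \<longleftrightarrow> x mod v = y mod v"
    using t_nonneg by (simp add: pt_def nat_eq_iff)
  then show ?thesis
    by (simp add: mod_eq_dvd_iff)
qed

lemma small_multiple:
  assumes "v dvd x" "- v < x" "x < v"
  shows "x = 0"
  using assms dvd_imp_le_int [of x v] t_nonneg by linarith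

text \<open>Matching the endpoints crosswise would make \<open>d + d'\<close> a multiple of
  \<open>v\<close>, but it lies strictly between \<open>0\<close> and \<open>v\<close>.\<close>

lemma seg_eqD:
  assumes "seg x d = seg y d'" "1 \<le> d" "d \<le> 4 * t" "1 \<le> d'" "d' \<le> 4 * t"
  shows "d = d' \<and> v dvd x - y"
proof -
  consider "v dvd x - y" "v dvd x + d - (y + d')" | "v dvd x - (y + d')" "v dvd x + d - y"
    using assms(1) by (auto simp: seg_def doubleton_eq_iff pt_eq_iff)
  then show ?thesis
  proof cases
    case 1
    then have "v dvd d - d'"
      using dvd_diff [of v "x + d - (y + d')" "x - y"] by (simp add: algebra_simps)
    then show ?thesis
      using small_multiple [of "d - d'"] assms 1 by simp
  next
    case 2
    then have "v dvd d + d'"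
      using dvd_diff [of v "x + d - y" "x - (y + d')"] by (simp add: algebra_simps)
    then show ?thesis
      using small_multiple [of "d + d'"] assms by simp
  qed
qed

lemma seg_cong:
  assumes "v dvd x - y" "v dvd d - d'"
  shows "seg x d = seg y d'"
proof -
  have "v dvd x + d - (y + d')"
    using dvd_add [OF assms] by (simp add: algebra_simps)
  then show ?thesis
    using assms(1) unfolding seg_def pt_eq_iff [symmetric] by simp
qed

lemma seg_flip:
  shows "seg x d = seg (x + d) (v - d)"
proof -
  have "pt (x + d + (v - d)) = pt x"
    by (simp add: pt_eq_iff)
  then show ?thesis
    by (auto simp: seg_def)
qed

text \<open>Offset from \<open>s\<close> at which the edge of length \<open>4 * i + r\<close> begins
  when it is traversed in the positive direction.\<close>

definition start :: "int \<Rightarrow> int \<Rightarrow> int" where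
  "start i r = (if r = 1 then 0 else if r = 2 then - 1 else - 4 * i - 4)"

lemma cyc_eq_segs:
  "cyc i s = {seg s (4 * i + 1), seg (s - 1) (4 * i + 2), seg (s - 4 * i - 4) (4 * i + 3),
    seg (s - 4 * i - 4) (4 * i + 4)}"
proof -
  have *: "s - 1 + (4 * i + 2) = s + 4 * i + 1" "s - 4 * i - 4 + (4 * i + 3) = s - 1"
    "s - 4 * i - 4 + (4 * i + 4) = s" "s + (4 * i + 1) = s + 4 * i + 1"
    by auto
  show ?thesis
    unfolding cyc_def cycle4_def seg_def * by (simp only: insert_commute)
qed

lemma in_cyc_iff: "e \<in> cyc i s \<longleftrightarrow> (\<exists>r\<in>{1..4}. e = seg (s + start i r) (4 * i + r))"
proof -
  have "{1..4::int} = {1, 2, 3, 4}"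
    by auto
  then show ?thesis
    by (simp add: cyc_eq_segs start_def algebra_simps)
qed

lemma Union_cyc: "\<Union>(cyc i s) = {pt s, pt (s + 4 * i + 1), pt (s - 1), pt (s - 4 * i - 4)}"
  by (auto simp: cyc_def cycle4_def)

lemma is_4_cycle_cyc:
  assumes "i \<in> {0..<t}"
  shows "is_4_cycle (cyc i s)"
proof -
  \<comment> \<open>The largest difference between two of the points is \<open>8 * i + 5\<close>,
    which stays below \<open>v\<close> because \<open>i < t\<close>.\<close>
  have "\<not> v dvd d" if "d \<noteq> 0" "- v < d" "d < v" for d
    using small_multiple that by blast
  then have "distinct [pt s, pt (s + 4 * i + 1), pt (s - 1), pt (s - 4 * i - 4)]"
    using assms by (auto simp: pt_eq_iff)
  then show ?thesis
    unfolding is_4_cycle_def cyc_def by blast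
qed

text \<open>The length \<open>4 * i + r\<close> with \<open>1 \<le> r \<le> 4\<close> determines
  \<open>i\<close> and \<open>r\<close>; the position of the edge then determines the
  translate.\<close>

lemma cyc_unique:
  assumes "e \<in> cyc i s" "e \<in> cyc j u" "i \<in> {0..<t}" "j \<in> {0..<t}" "s \<in> {0..<v}" "u \<in> {0..<v}"
  shows "i = j \<and> s = u"
proof -
  obtain r where r: "r \<in> {1..4}" "e = seg (s + start i r) (4 * i + r)"
    using assms(1) unfolding in_cyc_iff by blast
  obtain q where q: "q \<in> {1..4}" "e = seg (u + start j q) (4 * j + q)"
    using assms(2) unfolding in_cyc_iff by blast
  have eq: "4 * i + r = 4 * j + q" and dvd: "v dvd s + start i r - (u + start j q)"
    using seg_eqD [of "s + start i r" "4 * i + r" "u + start j q" "4 * j + q"] r q assms(3,4) by auto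
  have "i = j"
    using eq r(1) q(1) by auto
  moreover from this have "r = q"
    using eq by simp
  ultimately have "v dvd s - u"
    using dvd by simp
  then show ?thesis
    using \<open>i = j\<close> small_multiple [of "s - u"] assms(5,6) by auto
qed

lemma ex_cyc_seg:
  assumes "1 \<le> d" "d \<le> 4 * t"
  shows "\<exists>i s. i \<in> {0..<t} \<and> s \<in> {0..<v} \<and> seg x d \<in> cyc i s"
proof -
  \<comment> \<open>The remainder \<open>r\<close> runs over \<open>1..4\<close> instead of
    \<open>0..3\<close>, hence the shift by one before dividing.\<close>
  define i where "i = (d - 1) div 4"
  define r where "r = d - 4 * i"
  have r: "d = 4 * i + r" "1 \<le> r" "r \<le> 4"
    unfolding r_def i_def by presburger+
  have i: "i \<in> {0..<t}"
    using assms unfolding i_def by auto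
  define y where "y = x - start i r"
  define s where "s = y mod v"
  have s: "s \<in> {0..<v}"
    using t_nonneg pos_mod_sign [of v y] pos_mod_bound [of v y] unfolding s_def by simp
  have "v dvd y - s"
    unfolding s_def by (simp add: minus_mod_eq_mult_div)
  then have "seg x d = seg (x + s - y) d"
    by (intro seg_cong) (auto simp: algebra_simps)
  also have "\<dots> \<in> cyc i s"
    using r unfolding in_cyc_iff y_def by (intro bexI [of _ r]) (auto simp: algebra_simps)
  finally have "seg x d \<in> cyc i s" .
  then show ?thesis
    using i s by blast
qed

lemma four_cycle_system_cycles: "four_cycle_system {0..<nat v} cycles"
  unfolding four_cycle_system_def
proof (intro conjI ballI)
  show "is_4_cycle E" if "E \<in> cycles" for E
    using that is_4_cycle_cyc unfolding cycles_def by auto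
  have pt_less: "pt x < nat v" for x
    using t_nonneg pos_mod_bound [of v x] unfolding pt_def by simp
  show "partition_on (nsets {0..<nat v} 2) cycles"
  proof (rule partition_onI)
    show "\<Union>cycles = nsets {0..<nat v} 2"
    proof (intro subset_antisym subsetI)
      fix e assume "e \<in> \<Union>cycles"
      then obtain i s where i_s: "i \<in> {0..<t}" "e \<in> cyc i s"
        unfolding cycles_def by auto
      obtain a b c d where "distinct [a, b, c, d]" "cyc i s = cycle4 a b c d"
        using is_4_cycle_cyc [OF i_s(1)] unfolding is_4_cycle_def by blast
      then have "card e = 2"
        using i_s(2) by (auto simp: cycle4_def)
      moreover have "e \<subseteq> {0..<nat v}"
        using i_s(2) pt_less by (auto simp: cyc_def cycle4_def)
      ultimately show "e \<in> nsets {0..<nat v} 2"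
        by (auto simp: nsets_def intro: finite_subset)
    next
      fix e assume "e \<in> nsets {0..<nat v} 2"
      then obtain a b where e: "e = {a, b}" "a < nat v" "b < nat v" "a < b"
        by (auto simp: nsets_def card_2_iff) (metis insert_commute linorder_neqE_nat)
      have pt: "pt (int a) = a" "pt (int b) = b"
        using e unfolding pt_def by auto
      define d where "d = int b - int a"
      have "e = seg (int a) d"
        using pt by (simp add: seg_def d_def e)
      \<comment> \<open>As \<open>v\<close> is odd, exactly one of the two directions around the
        circle has length at most \<open>4 * t\<close>.\<close>
      moreover have "1 \<le> d \<and> d \<le> 4 * t \<or> 1 \<le> v - d \<and> v - d \<le> 4 * t"
        using e unfolding d_def by auto
      ultimately obtain x d' where "e = seg x d'" "1 \<le> d'" "d' \<le> 4 * t"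
        using seg_flip [of "int a" d] by metis
      then show "e \<in> \<Union>cycles"
        using ex_cyc_seg [of d' x] unfolding cycles_def by blast
    qed
    show "{} \<notin> cycles"
      by (auto simp: cycles_def cyc_def cycle4_def)
    show "disjnt E F" if EF: "E \<in> cycles" "F \<in> cycles" "E \<noteq> F" for E F
    proof -
      obtain i s where i: "E = cyc i s" "i \<in> {0..<t}" "s \<in> {0..<v}"
        using EF(1) unfolding cycles_def by blast
      obtain j u where j: "F = cyc j u" "j \<in> {0..<t}" "u \<in> {0..<v}"
        using EF(2) unfolding cycles_def by blast
      have "e \<notin> cyc j u" if "e \<in> cyc i s" for e
        using cyc_unique [OF that] i j EF(3) by blast
      then show ?thesis
        using i(1) j(1) unfolding disjnt_def by blast
    qed
  qed
qed auto

text \<open>A pair shared by two cycles is a diagonal of one of them.  The diagonal through \<open>s - 1\<close> and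
  \<open>s\<close> is an edge of a cycle with index \<open>0\<close>; the other one, of length \<open>8 * i + 5\<close>, is an edge of a
  cycle whose index is \<open>tent i\<close>.\<close>

definition tent :: "int \<Rightarrow> int" where
  "tent i = (if 2 * i + 1 < t then 2 * i + 1 else 2 * (t - 1 - i))"

text \<open>A necessary condition for an edge of \<open>cyc j u\<close> to be a diagonal of
  \<open>cyc i s\<close>; the disjuncts belong to the two diagonals.\<close>

definition leads :: "int \<Rightarrow> int \<Rightarrow> int \<Rightarrow> int \<Rightarrow> bool" where
  "leads i s j u \<longleftrightarrow> j = 0 \<and> v dvd u - s + 1 \<or> j = tent i \<and> v dvd u - s + 4 * i + 4"

text \<open>Three disjuncts describe two diagonals: the long one is recorded in whichever direction
  has length at most \<open>4 * t\<close>, as \<open>seg_eqD\<close> requires.\<close>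

definition diagonal :: "int \<Rightarrow> int \<Rightarrow> nat set \<Rightarrow> bool" where
  "diagonal i s e \<longleftrightarrow> (\<exists>x d. e = seg x d \<and> 1 \<le> d \<and> d \<le> 4 * t \<and>
     (d = 1 \<and> x = s - 1 \<or> d = 8 * i + 5 \<and> x = s - 4 * i - 4 \<or> d = 8 * t - 8 * i - 4 \<and> x = s + 4 * i + 1))"

lemma edge_or_diagonal:
  assumes "i \<in> {0..<t}" "{a, b} \<subseteq> \<Union>(cyc i s)" "a \<noteq> b"
  shows "{a, b} \<in> cyc i s \<or> diagonal i s {a, b}"
proof -
  consider "{a, b} \<in> cyc i s" | "{a, b} = {pt s, pt (s - 1)}"
    | "{a, b} = {pt (s + 4 * i + 1), pt (s - 4 * i - 4)}"
  proof -
    have "a \<in> {pt s, pt (s + 4 * i + 1), pt (s - 1), pt (s - 4 * i - 4)}"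
      "b \<in> {pt s, pt (s + 4 * i + 1), pt (s - 1), pt (s - 4 * i - 4)}"
      using assms(2) unfolding Union_cyc by blast+
    then show ?thesis
      using that assms(3) unfolding cyc_def cycle4_def insert_iff empty_iff
      by (elim disjE) (simp_all add: insert_commute)
  qed
  then show ?thesis
  proof cases
    case 2
    then have "{a, b} = seg (s - 1) 1"
      by (auto simp: seg_def)
    then show ?thesis
      using assms(1) unfolding diagonal_def by fastforce
  next
    case 3
    then have *: "{a, b} = seg (s - 4 * i - 4) (8 * i + 5)"
      by (auto simp: seg_def algebra_simps)
    also have "\<dots> = seg (s + 4 * i + 1) (8 * t - 8 * i - 4)"
      using seg_flip [of "s - 4 * i - 4" "8 * i + 5"] by (simp add: algebra_simps)
    finally have "{a, b} = seg (s + 4 * i + 1) (8 * t - 8 * i - 4)" .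
    moreover have "8 * i + 5 \<le> 4 * t \<or> 8 * t - 8 * i - 4 \<le> 4 * t"
      by presburger
    ultimately show ?thesis
      using * assms(1) unfolding diagonal_def by fastforce
  qed simp
qed

text \<open>Equating \<open>4 * j + r\<close> with the length of the diagonal fixes \<open>r\<close>
  modulo \<open>4\<close>, and then \<open>j\<close>; \<open>j < t\<close> selects the branch of
  \<open>tent\<close>.\<close>

lemma leads_if_edge_diagonal:
  assumes "i \<in> {0..<t}" "j \<in> {0..<t}" "e \<in> cyc j u" "diagonal i s e"
  shows "leads i s j u"
proof -
  obtain r where r: "r \<in> {1..4}" "e = seg (u + start j r) (4 * j + r)"
    using assms(3) unfolding in_cyc_iff by blast
  obtain x d where d: "e = seg x d" "1 \<le> d" "d \<le> 4 * t"
    and xd: "d = 1 \<and> x = s - 1 \<or> d = 8 * i + 5 \<and> x = s - 4 * i - 4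
      \<or> d = 8 * t - 8 * i - 4 \<and> x = s + 4 * i + 1"
    using assms(4) unfolding diagonal_def by blast
  have len: "4 * j + r = d" and dvd: "v dvd u + start j r - x"
    using seg_eqD [of "u + start j r" "4 * j + r" x d] r d assms(2) by auto
  from xd show ?thesis
  proof (elim disjE conjE)
    assume "d = 1" "x = s - 1"
    then have "4 * j + r = 1" "0 \<le> j" "1 \<le> r"
      using len r(1) assms(2) by auto
    then have "j = 0" "r = 1"
      by presburger+
    then show ?thesis
      using dvd \<open>x = s - 1\<close> by (simp add: leads_def start_def algebra_simps)
  next
    assume eq: "d = 8 * i + 5" "x = s - 4 * i - 4"
    then have "4 * j + r = 8 * i + 5" "1 \<le> r" "r \<le> 4"
      using len r(1) by auto
    then have "j = 2 * i + 1" "r = 1"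
      by presburger+
    then show ?thesis
      using dvd eq assms(2) by (simp add: leads_def tent_def start_def algebra_simps)
  next
    assume eq: "d = 8 * t - 8 * i - 4" "x = s + 4 * i + 1"
    then have "4 * j + r = 8 * t - 8 * i - 4" "1 \<le> r" "r \<le> 4"
      using len r(1) by auto
    then have j: "j = 2 * (t - 1 - i)" "r = 4"
      by presburger+
    \<comment> \<open>The short direction begins at the other end of the diagonal, which costs one
      full turn \<open>v\<close>.\<close>
    then have "u - s + 4 * i + 4 = (u + start j r - x) + v"
      using eq by (simp add: start_def)
    then have "v dvd u - s + 4 * i + 4"
      using dvd by (metis dvd_add dvd_refl)
    then show ?thesis
      using j assms(2) by (simp add: leads_def tent_def)
  qed
qed

text \<open>The lengths are \<open>1\<close>, \<open>5\<close> or \<open>4\<close> modulo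
  \<open>8\<close>, so equal lengths mean diagonals of the same kind, and for the long ones also
  \<open>i = j\<close>. The starting points then differ by \<open>s - u\<close>.\<close>

lemma eq_if_common_diagonal:
  assumes "s \<in> {0..<v}" "u \<in> {0..<v}" "diagonal i s e" "diagonal j u e"
  shows "s = u"
proof -
  obtain x d where d: "e = seg x d" "1 \<le> d" "d \<le> 4 * t"
    and xd: "d = 1 \<and> x = s - 1 \<or> d = 8 * i + 5 \<and> x = s - 4 * i - 4
      \<or> d = 8 * t - 8 * i - 4 \<and> x = s + 4 * i + 1"
    using assms(3) unfolding diagonal_def by blast
  obtain y d' where d': "e = seg y d'" "1 \<le> d'" "d' \<le> 4 * t"
    and yd': "d' = 1 \<and> y = u - 1 \<or> d' = 8 * j + 5 \<and> y = u - 4 * j - 4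
      \<or> d' = 8 * t - 8 * j - 4 \<and> y = u + 4 * j + 1"
    using assms(4) unfolding diagonal_def by blast
  have "d = d'" and dvd: "v dvd x - y"
    using seg_eqD [of x d y d'] d d' by auto
  have "x - y = s - u"
    using \<open>d = d'\<close> xd yd' by presburger
  then show ?thesis
    using dvd small_multiple [of "s - u"] assms(1,2) by auto
qed

text \<open>The pair cannot be an edge of both cycles. An edge of one and diagonal of the other
  gives \<open>leads\<close>, a common diagonal gives \<open>s = u\<close>.\<close>

lemma shared_pair_cases:
  assumes "i \<in> {0..<t}" "j \<in> {0..<t}" "s \<in> {0..<v}" "u \<in> {0..<v}" "cyc i s \<noteq> cyc j u"
    and "card (\<Union>(cyc i s) \<inter> \<Union>(cyc j u)) = 2"
  shows "s = u \<or> leads i s j u \<or> leads j u i s"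
proof -
  obtain a b where "\<Union>(cyc i s) \<inter> \<Union>(cyc j u) = {a, b}" "a \<noteq> b"
    using assms(6) by (auto simp: card_2_iff)
  then have "{a, b} \<in> cyc i s \<or> diagonal i s {a, b}" "{a, b} \<in> cyc j u \<or> diagonal j u {a, b}"
    using edge_or_diagonal assms(1,2) by blast+
  then show ?thesis
    using cyc_unique [of "{a, b}" i s j u] leads_if_edge_diagonal eq_if_common_diagonal assms
    by blast
qed

section \<open>Translation differences around a triangle\<close>

definition shift :: "int \<Rightarrow> int \<Rightarrow> int \<Rightarrow> bool" where
  "shift i j x \<longleftrightarrow> x = 0 \<and> i \<noteq> j \<or> x = - 1 \<and> j = 0 \<or> x = 1 \<and> i = 0
     \<or> x = - 4 * i - 4 \<and> j = tent i \<or> x = 4 * j + 4 \<and> i = tent j"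

lemma shift_swap: "shift i j x \<Longrightarrow> shift j i (- x)"
  by (auto simp: shift_def)

text \<open>Translates \<open>u - s\<close> into \<open>shift\<close>: \<open>0\<close> for a common
  diagonal, where distinct cycles need \<open>i \<noteq> j\<close>; negative values for a diagonal
  of the first cycle that is an edge of the second, positive values for the reverse.\<close>

lemma shift_if_shared_pair:
  assumes "i \<in> {0..<t}" "j \<in> {0..<t}" "s \<in> {0..<v}" "u \<in> {0..<v}" "cyc i s \<noteq> cyc j u"
    and "card (\<Union>(cyc i s) \<inter> \<Union>(cyc j u)) = 2"
  obtains x where "shift i j x" "v dvd u - s - x"
proof -
  have rev: "v dvd u - s - x" if "v dvd s - u + x" for x
    using that by (subst dvd_minus_iff [symmetric]) (simp add: algebra_simps)
  consider "s = u" | "leads i s j u" | "leads j u i s"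
    using shared_pair_cases [OF assms] by blast
  then show thesis
  proof cases
    case 1
    then have "i \<noteq> j"
      using assms(5) by blast
    then show thesis
      using 1 that [of 0] by (simp add: shift_def)
  next
    case 2
    then show thesis
      using that [of "- 1"] that [of "- 4 * i - 4"]
      by (auto simp: leads_def shift_def algebra_simps)
  next
    case 3
    then show thesis
      using that [of 1] that [of "4 * j + 4"] rev [of 1] rev [of "4 * j + 4"]
      by (auto simp: leads_def shift_def add.assoc)
  qed
qed

lemma shift_cases:
  assumes "shift i j x" "x \<noteq> 0" "x \<noteq> 1" "x \<noteq> - 1"
  shows "x = - 4 * i - 4 \<or> x = 4 * j + 4"
  using assms by (auto simp: shift_def)

text \<open>Only the long diagonal of the last base cycle shifts this far; its short length is
  \<open>4\<close>, an edge length of the base cycle \<open>0\<close>.\<close>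

lemma shift_max:
  assumes "2 \<le> t" "i \<in> {0..<t}" "j \<in> {0..<t}" "shift i j (4 * t)"
  shows "i = 0 \<and> j = t - 1"
proof -
  have "4 * t = 4 * j + 4" "i = tent j"
    using assms by (auto simp: shift_def)
  then show ?thesis
    using assms(1) by (auto simp: tent_def)
qed

text \<open>As \<open>v\<close> is \<open>1\<close> modulo \<open>4\<close>, some shift is not a
  multiple of \<open>4\<close>, hence at most \<open>1\<close>. The other two must both be
  \<open>4 * t\<close>, so by \<open>shift_max\<close> the index between them is both
  \<open>t - 1\<close> and \<open>0\<close>. For \<open>t = 1\<close> the sum
  \<open>1 + 4 + 4 = 9\<close> does occur.\<close>

lemma shift_sum_neq_modulus:
  assumes "2 \<le> t" and ijk: "i \<in> {0..<t}" "j \<in> {0..<t}" "k \<in> {0..<t}"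
    and sh: "shift i j x" "shift j k y" "shift k i z"
  shows "x + y + z \<noteq> v"
proof
  assume sum: "x + y + z = v"
  have form: "(w \<le> 1 \<or> 4 dvd w) \<and> w \<le> 4 * t"
    if "shift a b w" "a \<in> {0..<t}" "b \<in> {0..<t}" for a b w
    using that \<open>2 \<le> t\<close> by (auto simp: shift_def)
  note xyz = form [OF sh(1) ijk(1,2)] form [OF sh(2) ijk(2,3)] form [OF sh(3) ijk(3,1)]
  have "\<not> (4 dvd x \<and> 4 dvd y \<and> 4 dvd z)"
    using sum by presburger
  then have "x \<le> 1 \<or> y \<le> 1 \<or> z \<le> 1"
    using xyz by blast
  then have "x = 4 * t \<and> y = 4 * t \<or> y = 4 * t \<and> z = 4 * t \<or> z = 4 * t \<and> x = 4 * t"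
    using xyz sum \<open>2 \<le> t\<close> by linarith
  then show False
    using shift_max [OF \<open>2 \<le> t\<close> ijk(1,2)] shift_max [OF \<open>2 \<le> t\<close> ijk(2,3)]
      shift_max [OF \<open>2 \<le> t\<close> ijk(3,1)] sh \<open>2 \<le> t\<close> by auto
qed

text \<open>In all other cases \<open>y\<close> and \<open>k\<close> determine the source index:
  \<open>0\<close> for \<open>y = 1\<close>, \<open>- y / 4 - 1\<close> for a negative multiple of
  \<open>4\<close>, \<open>tent k\<close> for a positive one.\<close>

lemma shift_unique_target:
  assumes "shift i k y" "shift j k y" "i \<noteq> j" "i \<in> {0..<t}" "j \<in> {0..<t}" "k \<in> {0..<t}"
  shows "y = 0 \<or> y = - 1 \<and> k = 0"
  using assms by (auto simp: shift_def) presburger+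

text \<open>Modulo \<open>4\<close>, three nonzero shifts with sum zero are all multiples of
  \<open>4\<close>. With equal signs they cannot cancel; with mixed signs two of them cancel and the
  third remains.\<close>

lemma shift_sum_zero:
  assumes ijk: "i \<in> {0..<t}" "j \<in> {0..<t}" "k \<in> {0..<t}"
    and sh: "shift i j x" "shift j k y" "shift k i z" and sum: "x + y + z = 0"
  shows "x = 0 \<or> y = 0 \<or> z = 0"
proof (rule ccontr)
  assume "\<not> ?thesis"
  then have nz: "x \<noteq> 0" "y \<noteq> 0" "z \<noteq> 0"
    by auto
  have form: "w = 1 \<or> w = - 1 \<or> 4 dvd w" if "shift a b w" for a b w
    using that by (auto simp: shift_def)
  have "4 dvd x \<and> 4 dvd y \<and> 4 dvd z"
    using form [OF sh(1)] form [OF sh(2)] form [OF sh(3)] sum nz by presburger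
  then have "x \<noteq> 1" "x \<noteq> - 1" "y \<noteq> 1" "y \<noteq> - 1" "z \<noteq> 1" "z \<noteq> - 1"
    by auto
  then have "x = - 4 * i - 4 \<or> x = 4 * j + 4" "y = - 4 * j - 4 \<or> y = 4 * k + 4"
      "z = - 4 * k - 4 \<or> z = 4 * i + 4"
    using shift_cases sh nz by blast+
  then show False
    using sum nz ijk by auto
qed

lemma shift_triangle:
  assumes "2 \<le> t" and ijk: "i \<in> {0..<t}" "j \<in> {0..<t}" "k \<in> {0..<t}"
    and sh: "shift i j x" "shift j k y" "shift k i z" and "v dvd x + y + z"
  shows "x = 0 \<and> y = 0 \<and> z = 0 \<or> x = 0 \<and> y = - 1 \<and> z = 1 \<and> k = 0
    \<or> y = 0 \<and> z = - 1 \<and> x = 1 \<and> i = 0 \<or> z = 0 \<and> x = - 1 \<and> y = 1 \<and> j = 0"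
proof -
  have bound: "- 4 * t \<le> w \<and> w \<le> 4 * t" if "shift a b w" "a \<in> {0..<t}" "b \<in> {0..<t}" for a b w
    using that by (auto simp: shift_def)
  have le: "x + y + z \<le> 12 * t" "- 12 * t \<le> x + y + z"
    using bound [OF sh(1)] bound [OF sh(2)] bound [OF sh(3)] ijk by auto
  have "x + y + z \<noteq> v"
    by (rule shift_sum_neq_modulus [OF assms(1) ijk sh])
  \<comment> \<open>The value \<open>- v\<close> is excluded by going around the triangle in the
    opposite direction.\<close>
  moreover have "- z + - y + - x \<noteq> v"
    using shift_sum_neq_modulus [OF assms(1) ijk(1,3,2)] sh [THEN shift_swap] by blast
  moreover obtain c where c: "x + y + z = v * c"
    using \<open>v dvd x + y + z\<close> by (elim dvdE)
  moreover have "c < 2" "- 2 < c"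
  proof -
    have "v * c < v * 2" "v * (- 2) < v * c" "0 < v"
      using c le t_nonneg by auto
    then show "c < 2" "- 2 < c"
      using mult_less_cancel_left_pos by blast+
  qed
  then have "c = 0 \<or> c = 1 \<or> c = - 1"
    by linarith
  ultimately have sum: "x + y + z = 0"
    by auto
  \<comment> \<open>A zero shift joins two different indices \<open>a\<close> and \<open>b\<close>,
    and both reach \<open>b'\<close> by the same shift \<open>q\<close>.\<close>
  have step: "q = 0 \<or> q = - 1 \<and> b' = 0"
    if "shift a b 0" "shift b b' q" "shift b' a (- q)" "a \<in> {0..<t}" "b \<in> {0..<t}" "b' \<in> {0..<t}"
    for a b b' q
    using shift_unique_target [of a b' q b] shift_swap [OF that(3)] that by (auto simp: shift_def)
  from shift_sum_zero [OF ijk sh sum] show ?thesis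
  proof (elim disjE)
    assume "x = 0"
    then show ?thesis
      using step [of i j k y] sh ijk sum by (auto simp: add_eq_0_iff)
  next
    assume "y = 0"
    then show ?thesis
      using step [of j k i z] sh ijk sum by (auto simp: add_eq_0_iff)
  next
    assume "z = 0"
    then show ?thesis
      using step [of k i j x] sh ijk sum by (auto simp: add_eq_0_iff)
  qed
qed

text \<open>The pair is the short diagonal of the translate at \<open>p\<close>, or the edge of
  length \<open>1\<close> of a cycle of index \<open>0\<close> translated to
  \<open>p - 1\<close>.\<close>

lemma small_diagonal_in_cyc:
  assumes "v dvd s - p \<or> i = 0 \<and> v dvd s - p + 1"
  shows "{pt p, pt (p - 1)} \<subseteq> \<Union>(cyc i s)"
proof -
  have "pt s = pt p \<and> pt (s - 1) = pt (p - 1)" if "v dvd s - p"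
    using that by (simp add: pt_eq_iff)
  moreover have "pt s = pt (p - 1) \<and> pt (s + 1) = pt p" if "v dvd s - p + 1"
    using that by (simp add: pt_eq_iff algebra_simps)
  ultimately show ?thesis
    using assms by (auto simp: Union_cyc)
qed

lemma triangle_has_common_pair:
  assumes "2 \<le> t" "E \<in> cycles" "F \<in> cycles" "G \<in> cycles" "distinct [E, F, G]"
    and "triangle (\<Union>E) (\<Union>F) (\<Union>G)"
  shows "2 \<le> card (\<Union>E \<inter> \<Union>F \<inter> \<Union>G)"
proof -
  obtain i s where E: "E = cyc i s" "i \<in> {0..<t}" "s \<in> {0..<v}"
    using assms(2) unfolding cycles_def by blast
  obtain j u where F: "F = cyc j u" "j \<in> {0..<t}" "u \<in> {0..<v}"
    using assms(3) unfolding cycles_def by blast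
  obtain k w where G: "G = cyc k w" "k \<in> {0..<t}" "w \<in> {0..<v}"
    using assms(4) unfolding cycles_def by blast
  obtain x where x: "shift i j x" "v dvd u - s - x"
    using assms(5,6) E F by (auto simp: triangle_def intro: shift_if_shared_pair [of i j s u])
  obtain y where y: "shift j k y" "v dvd w - u - y"
    using assms(5,6) F G by (auto simp: triangle_def intro: shift_if_shared_pair [of j k u w])
  obtain z where z: "shift k i z" "v dvd s - w - z"
    using assms(5,6) E G
    by (auto simp: triangle_def Int_commute intro: shift_if_shared_pair [of k i w s])
  have "v dvd - ((u - s - x) + (w - u - y) + (s - w - z))"
    using x(2) y(2) z(2) by (intro dvd_add iffD2 [OF dvd_minus_iff])
  then have "v dvd x + y + z"
    by (simp add: algebra_simps)
  \<comment> \<open>The witness \<open>p\<close> is the common translate of the three cycles, or of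
    the two other than the one of index \<open>0\<close> that is displaced by
    \<open>- 1\<close>.\<close>
  from shift_triangle [OF assms(1) E(2) F(2) G(2) x(1) y(1) z(1) this]
  obtain p where "v dvd s - p \<or> i = 0 \<and> v dvd s - p + 1" "v dvd u - p \<or> j = 0 \<and> v dvd u - p + 1"
    "v dvd w - p \<or> k = 0 \<and> v dvd w - p + 1"
  proof (elim disjE conjE)
    assume "x = 0" "y = 0" "z = 0"
    then show thesis
      using that [of w] x(2) y(2) z(2) by (simp add: dvd_diff_commute)
  next
    assume "x = 0" "y = - 1" "z = 1" "k = 0"
    then show thesis
      using that [of u] x(2) y(2) z(2) by (simp add: dvd_diff_commute)
  next
    assume "y = 0" "z = - 1" "x = 1" "i = 0"
    then show thesis
      using that [of w] x(2) y(2) z(2) by (simp add: dvd_diff_commute)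
  next
    assume "z = 0" "x = - 1" "y = 1" "j = 0"
    then show thesis
      using that [of s] x(2) y(2) z(2) by (simp add: dvd_diff_commute)
  qed
  then have "{pt p, pt (p - 1)} \<subseteq> \<Union>E \<inter> \<Union>F \<inter> \<Union>G"
    using small_diagonal_in_cyc unfolding E(1) F(1) G(1) by blast
  moreover have "card {pt p, pt (p - 1)} = 2"
    using small_multiple [of 1] assms(1) by (auto simp: pt_eq_iff)
  moreover have "finite (\<Union>E \<inter> \<Union>F \<inter> \<Union>G)"
    unfolding E(1) Union_cyc by simp
  ultimately show ?thesis
    by (metis card_mono)
qed

lemma sparse_system_cycles:
  assumes "2 \<le> t"
  shows "sparse_system 4 cycles"
proof (rule sparse_system_4_if_triangles_large)
  have sys: "four_cycle_system {0..<nat v} cycles"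
    by (rule four_cycle_system_cycles)
  then show cyc4: "is_4_cycle E" if "E \<in> cycles" for E
    using that unfolding four_cycle_system_def by blast
  show "disjoint cycles"
    using sys unfolding four_cycle_system_def partition_on_def by blast
  show "8 \<le> card (\<Union>E \<union> \<Union>F \<union> \<Union>G)"
    if EFG: "E \<in> cycles" "F \<in> cycles" "G \<in> cycles" "distinct [E, F, G]"
      "triangle (\<Union>E) (\<Union>F) (\<Union>G)" for E F G
    using triangle_has_common_pair [OF assms EFG] EFG card_Union_is_4_cycle [OF cyc4]
    by (intro card_Un_triangle) auto
qed

section \<open>Order nine by exhaustive evaluation\<close>

lemma subseqs_map: "subseqs (map f xs) = map (map f) (subseqs xs)"
  by (induction xs) (simp_all add: Let_def)

text \<open>For \<open>t = 1\<close> there are triangles on seven points, but they do not extend to a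
  \<open>(7,4)\<close>-configuration.\<close>

lemma sparse_system_cycles_order_9:
  assumes "t = 1"
  shows "sparse_system 4 cycles"
  unfolding sparse_system_def
proof (intro allI impI notI)
  fix j :: nat assume "2 \<le> j \<and> j \<le> 4" and "\<exists>S. configuration (j + 3) j cycles S"
  then obtain S where S: "S \<subseteq> cycles" "card S = j" "card (\<Union>E\<in>S. \<Union>E) = j + 3"
    by (auto simp: configuration_def)
  define points where "points s = [s mod 9, (s + 1) mod 9, (s - 1) mod 9, (s - 4) mod 9]"
    for s :: int
  have points: "\<Union>(cyc 0 s) = nat ` set (points s)" for s
    unfolding Union_cyc pt_def points_def by (simp add: assms)
  have "cycles = cyc 0 ` set [0..8]"
  proof -
    have *: "i \<in> {0..<t} \<longleftrightarrow> i = 0" "s \<in> {0..<v} \<longleftrightarrow> s \<in> set [0..8]" for i s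
      unfolding set_upto atLeastLessThan_iff atLeastAtMost_iff assms by presburger+
    then show ?thesis
      unfolding cycles_def * by blast
  qed
  then have "S \<subseteq> cyc 0 ` set [0..8]"
    using S(1) by blast
  then obtain I where I: "I \<subseteq> set [0..8]" "inj_on (cyc 0) I" "S = cyc 0 ` I"
    unfolding subset_image_inj by blast
  then obtain xs where xs: "xs \<in> set (subseqs [0..8])" "I = set xs"
    using subset_subseqs [of I "[0..8]"] by blast
  define ys where "ys = map points xs"
  have ys: "ys \<in> set (subseqs (map points [0..8]))"
    unfolding ys_def subseqs_map set_map using xs(1) by (rule imageI)
  have "distinct xs"
    by (rule subseqs_distinctD [OF xs(1) distinct_upto])
  then have "length ys = j"
    using S(2) I xs(2) by (simp add: ys_def card_image distinct_card)
  moreover have "length (remdups (concat ys)) = j + 3"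
  proof -
    have "(\<Union>E\<in>S. \<Union>E) = nat ` set (concat ys)"
      using I(3) xs(2) points by (auto simp: ys_def)
    moreover have "inj_on nat (set (concat ys))"
      by (rule inj_onI) (auto simp: ys_def points_def nat_eq_iff split: if_splits)
    ultimately show ?thesis
      using S(3) by (simp add: card_image length_remdups_card_conv)
  qed
  \<comment> \<open>Evaluates every choice of two to four of the nine cycles; \<open>remdups\<close>
    makes the length count distinct vertices.\<close>
  moreover have "\<forall>ys\<in>set (subseqs (map points [0..8])).
      let l = length ys in 2 \<le> l \<and> l \<le> 4 \<longrightarrow> length (remdups (concat ys)) \<noteq> l + 3"
    unfolding points_def by code_simp
  from bspec [OF this ys]
  have "2 \<le> length ys \<and> length ys \<le> 4 \<longrightarrow> length (remdups (concat ys)) \<noteq> length ys + 3"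
    unfolding Let_def .
  ultimately show False
    using \<open>2 \<le> j \<and> j \<le> 4\<close> by blast
qed

end

theorem theorem4:
  fixes v :: nat
  assumes "v > 0"
  shows "(\<exists>(V :: nat set) C. card V = v \<and> four_cycle_system V C \<and> sparse_system 4 C)
           \<longleftrightarrow> [v = 1] (mod 8)"
proof
  assume "\<exists>(V :: nat set) C. card V = v \<and> four_cycle_system V C \<and> sparse_system 4 C"
  then obtain V :: "nat set" and C where "card V = v" "four_cycle_system V C"
    by blast
  moreover from this have "V \<noteq> {}"
    using assms by auto
  ultimately show "[v = 1] (mod 8)"
    using four_cycle_system_cong by blast
next
  assume "[v = 1] (mod 8)"
  then have "v mod 8 = 1"
    by (simp add: cong_def)
  define t where "t = int (v div 8)"
  have v: "8 * t + 1 = int v"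
    using \<open>v mod 8 = 1\<close> unfolding t_def by presburger
  interpret cyclic_4_cycles t
    by unfold_locales (simp add: t_def)
  have "four_cycle_system {0..<v} cycles"
    using four_cycle_system_cycles v by simp
  moreover have "sparse_system 4 cycles"
  proof -
    \<comment> \<open>The triangle argument covers \<open>2 \<le> t\<close>; order \<open>9\<close>
      has its own check, and order \<open>1\<close> has no cycles.\<close>
    consider "t = 0" | "t = 1" | "2 \<le> t"
      using t_nonneg by linarith
    then show ?thesis
    proof cases
      case 1
      then have "{0..<t} = {}"
        by simp
      then have "cycles = {}"
        unfolding cycles_def by blast
      then show ?thesis
        by (auto simp: sparse_system_def configuration_def)
    qed (fact sparse_system_cycles_order_9 sparse_system_cycles)+
  qed
  ultimately show "\<exists>(V :: nat set) C. card V = v \<and> four_cycle_system V C \<and> sparse_system 4 C"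
    by (metis card_atLeastLessThan diff_zero)
qed

end
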